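(* Let $a_0,a,p_0,p_1,p,R,C,T(x',\mu|\mathbf m),x_{\mathbf m},p_D(x'|x,\mu),\nu_F(x'|\mu)$ be as defined in the context. Then for every $x'\in\chi$ the false-alarm density at cost factor $\mu=1$ is determined by the detection density through $$\nu_F(x'|1) = -\int_1^\infty \frac{1}{\mu}\,\frac{\partial}{\partial\mu}\left[\int_{\chi}\frac{R(x',x)}{C(x')}\,p_D(x'|x,\mu)\,\frac{a(x)}{a_0}\,dx\right]d\mu .$$
   Context: Setting (joint Bayesian detection and estimation). The parameter space is $\{x_0\}\cup\chi$, where $x_0$ means "no signal" and $\chi$ is a continuous domain of dimension $d$. "No signal" has prior probability $a_0>0$, and signal parameters have prior density $a(x)$ on $\chi$, with $a_0+\int_\chi a(x)\,dx=1$. The measurement $\mathbf m$ takes values in a finite-dimensional real vector space. Its probability density is $p_0(\mathbf m)$ when no signal is present and $p_1(\mathbf m|x)$ when a signal with parameter $x\in\chi$ is present. The marginal density is $p(\mathbf m)=a_0p_0(\mathbf m)+\int_\chi a(x)p_1(\mathbf m|x)\,dx$. Costs. $C(x')>0$ is the cost of declaring a signal at $x'\in\chi$ when no signal is present (false alarm). The cost of a correct no-signal declaration is $0$. $R(x',x)\ge 0$ is the reward function: the cost of declaring a signal at $x$ absent minus the cost of declaring it present at $x'$. Costs are continuous and bounded. Decision statistic with false-alarm cost scaled by a factor $\mu>0$: $$T(x',\mu|\mathbf m)=\frac{1}{p(\mathbf m)}\left[\int_\chi R(x',x)p_1(\mathbf m|x)a(x)\,dx-\mu\,C(x')p_0(\mathbf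 m)a_0\right],\qquad T(x'|\mathbf m)=T(x',1|\mathbf m).$$ The location $x_{\mathbf m}\in\chi$ is the (almost surely unique) maximizer of $x'\mapsto T(x'|\mathbf m)$. A signal is declared at $x_{\mathbf m}$ when $T(x_{\mathbf m},\mu|\mathbf m)>0$. Densities over the parameter domain ($\delta$ is the Dirac delta on $\chi$): $$p_D(x'|x,\mu)=\int_{T(x_{\mathbf m},\mu|\mathbf m)>0}\delta(x'-x_{\mathbf m})\,p_1(\mathbf m|x)\,d\mathbf m,\qquad \nu_F(x'|\mu)=\int_{T(x_{\mathbf m},\mu|\mathbf m)>0}\delta(x'-x_{\mathbf m})\,p_0(\mathbf m)\,d\mathbf m .$$ That is, $p_D(\cdot|x,\mu)$ is the density in $x'$ of the measure $A\mapsto\Pr\big(x_{\mathbf m}\in A,\ T(x_{\mathbf m},\mu|\mathbf m)>0\big)$ when $\mathbf m\sim p_1(\cdot|x)$, and $\nu_F(\cdot|\mu)$ is the same with $\mathbf m\sim p_0$. The problem is assumed regular enough that these densities exist and are differentiable in $\mu$, that differentiation and integration may be interchanged, and that detections and false alarms vanish as $\mu\to\infty$.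
   Formalization: Densities are determined only up to null sets in x', so the claim for every x' also assumes that ν_F(x'|μ) and the integral over x of (R/C) p_D a/a_0 are continuous in x' on χ; otherwise changing ν_F at a single point would break it. *)

theory Defs
  imports "HOL-Probability.Probability"
begin

definition marginal_density ::
  "'x::euclidean_space set \<Rightarrow> real \<Rightarrow> ('x \<Rightarrow> real) \<Rightarrow>
   ('m::euclidean_space \<Rightarrow> real) \<Rightarrow> ('m \<Rightarrow> 'x \<Rightarrow> real) \<Rightarrow> 'm \<Rightarrow> real"
where
  "marginal_density X a0 a p0 p1 m = a0 * p0 m + (LINT x:X|lborel. a x * p1 m x)"

definition decision_stat ::
  "'x::euclidean_space set \<Rightarrow> real \<Rightarrow> ('x \<Rightarrow> real) \<Rightarrow>
   ('m::euclidean_space \<Rightarrow> real) \<Rightarrow> ('m \<Rightarrow> 'x \<Rightarrow> real) \<Rightarrow>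
   ('x \<Rightarrow> real) \<Rightarrow> ('x \<Rightarrow> 'x \<Rightarrow> real) \<Rightarrow> 'x \<Rightarrow> real \<Rightarrow> 'm \<Rightarrow> real"
where
  "decision_stat X a0 a p0 p1 C R x' \<mu> m =
     1 / marginal_density X a0 a p0 p1 m *
       ((LINT x:X|lborel. R x' x * p1 m x * a x) - \<mu> * C x' * p0 m * a0)"

(* f is a density on X of the sub-probability measure A |-> Pr (loc m \<in> A and m \<in> D), where
   m has density q.  This is the meaning of
   f x' = integral over D of delta (x' - loc m) * q m.
   Off a null set of m, loc m may lie outside X; only A \<subseteq> X is tested. *)
definition is_location_density ::
  "'x::euclidean_space set \<Rightarrow> ('m::euclidean_space \<Rightarrow> 'x) \<Rightarrow> 'm set \<Rightarrow>
   ('m \<Rightarrow> real) \<Rightarrow> ('x \<Rightarrow> real) \<Rightarrow> bool"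
where
  "is_location_density X loc D q f \<longleftrightarrow>
     f \<in> borel_measurable (restrict_space borel X) \<and>
     (\<forall>x'\<in>X. 0 \<le> f x') \<and>
     (\<forall>A\<in>sets borel. A \<subseteq> X \<longrightarrow>
        emeasure (density lborel (\<lambda>m. ennreal (q m))) {m. loc m \<in> A \<and> m \<in> D} =
        (\<integral>\<^sup>+x'\<in>A. ennreal (f x') \<partial>lborel))"

(* X is the signal domain, a0 and a the prior, p1 m x the density of the measurement m given x,
   C x' the false-alarm cost and R x' x the reward. *)
locale detection_estimation =
  fixes X :: "'x::euclidean_space set"
    and a0 :: real
    and a :: "'x \<Rightarrow> real"
    and p0 :: "'m::euclidean_space \<Rightarrow> real"
    and p1 :: "'m \<Rightarrow> 'x \<Rightarrow> real"
    and C :: "'x \<Rightarrow> real"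
    and R :: "'x \<Rightarrow> 'x \<Rightarrow> real"
  (* Full-dimensional domain: open sets, closed boxes etc.  The last condition excludes points
     near which X has measure zero, where a density would carry no information. *)
  assumes domain_borel: "X \<in> sets borel"
    and domain_nonempty: "X \<noteq> {}"
    and domain_regular: "X \<subseteq> closure (interior X)"
    and a0_pos: "0 < a0"
    and a_nonneg: "\<And>x. x \<in> X \<Longrightarrow> 0 \<le> a x"
    and a_integrable: "set_integrable lborel X a"
    and prior_total: "a0 + (LINT x:X|lborel. a x) = 1"
    and p0_measurable: "p0 \<in> borel_measurable borel"
    and p0_nonneg: "\<And>m. 0 \<le> p0 m"
    and p0_prob: "prob_space (density lborel (\<lambda>m. ennreal (p0 m)))"
    and p1_measurable:
      "(\<lambda>(m, x). p1 m x) \<in> borel_measurable (borel \<Otimes>\<^sub>M restrict_space borel X)"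
    and p1_nonneg: "\<And>m x. x \<in> X \<Longrightarrow> 0 \<le> p1 m x"
    and p1_prob: "\<And>x. x \<in> X \<Longrightarrow> prob_space (density lborel (\<lambda>m. ennreal (p1 m x)))"
    and C_pos: "\<And>x'. x' \<in> X \<Longrightarrow> 0 < C x'"
    and C_continuous: "continuous_on X C"
    and C_bounded: "bounded (C ` X)"
    and R_nonneg: "\<And>x' x. x' \<in> X \<Longrightarrow> x \<in> X \<Longrightarrow> 0 \<le> R x' x"
    and R_continuous: "continuous_on (X \<times> X) (\<lambda>(x', x). R x' x)"
    and R_bounded: "bounded ((\<lambda>(x', x). R x' x) ` (X \<times> X))"

(* loc m is the maximizer x_m; pD x' x \<mu> and \<nu>F x' \<mu> are the detection and false-alarm
   densities at x'.  A density is determined only up to null sets in x'.  The two continuity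
   assumptions pin the values that are needed pointwise: \<nu>F itself, and the average of pD
   over x. *)
locale regular_detection_estimation =
  detection_estimation X a0 a p0 p1 C R
  for X :: "'x::euclidean_space set"
    and a0 :: real
    and a :: "'x \<Rightarrow> real"
    and p0 :: "'m::euclidean_space \<Rightarrow> real"
    and p1 :: "'m \<Rightarrow> 'x \<Rightarrow> real"
    and C :: "'x \<Rightarrow> real"
    and R :: "'x \<Rightarrow> 'x \<Rightarrow> real" +
  fixes loc :: "'m \<Rightarrow> 'x"
    and pD :: "'x \<Rightarrow> 'x \<Rightarrow> real \<Rightarrow> real"
    and \<nu>F :: "'x \<Rightarrow> real \<Rightarrow> real"
  assumes loc_measurable: "loc \<in> borel_measurable borel"
    and loc_unique_maximizer:
      "AE m in density lborel (\<lambda>m. ennreal (marginal_density X a0 a p0 p1 m)).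
         \<forall>y. is_arg_max (\<lambda>x'. decision_stat X a0 a p0 p1 C R x' 1 m) (\<lambda>x'. x' \<in> X) y
               \<longleftrightarrow> y = loc m"
    and pD_density:
      "\<And>x \<mu>. x \<in> X \<Longrightarrow> 0 < \<mu> \<Longrightarrow>
         is_location_density X loc {m. 0 < decision_stat X a0 a p0 p1 C R (loc m) \<mu> m}
           (\<lambda>m. p1 m x) (\<lambda>x'. pD x' x \<mu>)"
    and \<nu>F_density:
      "\<And>\<mu>. 0 < \<mu> \<Longrightarrow>
         is_location_density X loc {m. 0 < decision_stat X a0 a p0 p1 C R (loc m) \<mu> m}
           p0 (\<lambda>x'. \<nu>F x' \<mu>)"
    and pD_measurable:
      "\<And>\<mu>. 0 < \<mu> \<Longrightarrow> (\<lambda>(x', x). pD x' x \<mu>)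
         \<in> borel_measurable (restrict_space borel X \<Otimes>\<^sub>M restrict_space borel X)"
    and average_integrable:
      "\<And>x' \<mu>. x' \<in> X \<Longrightarrow> 0 < \<mu> \<Longrightarrow>
         set_integrable lborel X (\<lambda>x. R x' x / C x' * pD x' x \<mu> * (a x / a0))"
    and average_continuous:
      "\<And>\<mu>. 0 < \<mu> \<Longrightarrow>
         continuous_on X (\<lambda>x'. LINT x:X|lborel. R x' x / C x' * pD x' x \<mu> * (a x / a0))"
    and \<nu>F_continuous: "\<And>\<mu>. 0 < \<mu> \<Longrightarrow> continuous_on X (\<lambda>x'. \<nu>F x' \<mu>)"
    and pD_differentiable:
      "\<And>x' x \<mu>. x' \<in> X \<Longrightarrow> x \<in> X \<Longrightarrow> 0 < \<mu> \<Longrightarrow> (\<lambda>t. pD x' x t) differentiable (at \<mu>)"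
    and \<nu>F_differentiable:
      "\<And>x' \<mu>. x' \<in> X \<Longrightarrow> 0 < \<mu> \<Longrightarrow> (\<lambda>t. \<nu>F x' t) differentiable (at \<mu>)"
    and derivative_integrable:
      "\<And>x' \<mu>. x' \<in> X \<Longrightarrow> 0 < \<mu> \<Longrightarrow>
         set_integrable lborel X
           (\<lambda>x. R x' x / C x' * deriv (\<lambda>t. pD x' x t) \<mu> * (a x / a0))"
    and derivative_interchange:
      "\<And>x' \<mu>. x' \<in> X \<Longrightarrow> 0 < \<mu> \<Longrightarrow>
         ((\<lambda>t. LINT x:X|lborel. R x' x / C x' * pD x' x t * (a x / a0)) has_real_derivative
          (LINT x:X|lborel. R x' x / C x' * deriv (\<lambda>t. pD x' x t) \<mu> * (a x / a0))) (at \<mu>)"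
    and pD_vanishes:
      "\<And>x' x. x' \<in> X \<Longrightarrow> x \<in> X \<Longrightarrow> ((\<lambda>\<mu>. pD x' x \<mu>) \<longlongrightarrow> 0) at_top"
    and \<nu>F_vanishes: "\<And>x'. x' \<in> X \<Longrightarrow> ((\<lambda>\<mu>. \<nu>F x' \<mu>) \<longlongrightarrow> 0) at_top"

end

theory Submission
  imports Defs
begin

text \<open>
  Fix a location \<open>x'\<close>. Write \<open>G \<mu>\<close> for the average
  \<open>\<integral> R x' x / C x' * pD x' x \<mu> * (a x / a0) dx\<close> and \<open>\<nu> \<mu>\<close> for the false-alarm density
  at \<open>x'\<close>. The theorem amounts to the identity \<open>G' \<mu> = \<mu> * \<nu>' \<mu>\<close>: dividing by \<open>\<mu>\<close> and integrating
  over \<open>[1, \<infinity>)\<close> leaves \<open>0 - \<nu> 1\<close>, because false alarms vanish as \<open>\<mu> \<rightarrow> \<infinity>\<close>.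

  The identity is the first-order condition of a Neyman-Pearson argument. For a measurement \<open>m\<close> let
  \<open>b m = \<integral> R (loc m) x / C (loc m) * (a x / a0) * p1 m x dx\<close>. Wherever the
  marginal density is positive and \<open>b m\<close> is finite, the decision statistic has the sign of
  \<open>b m - \<mu> * p0 m\<close>; elsewhere no signal is declared. So the declaration region at cost factor \<open>\<mu>\<close>
  maximizes the integral of \<open>b m - \<mu> * p0 m\<close> among the declaration regions of all cost factors.
  Restricted to the measurements located in a set \<open>A\<close>, the integral of \<open>b\<close> over the region at factor \<open>t\<close> is \<open>\<integral>\<^sub>A G t dx'\<close> by Tonelli
  (\<open>nn_integral_average_detection\<close>), and the integral of \<open>p0\<close> is \<open>\<integral>\<^sub>A \<nu> t dx'\<close>. Since \<open>A\<close> is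
  arbitrary and the densities are continuous in \<open>x'\<close>, the comparison holds at every \<open>x'\<close>: for each
  fixed \<open>\<mu>\<close> the function \<open>t \<mapsto> G t - \<mu> * \<nu> t\<close> is maximal at \<open>t = \<mu>\<close>
  (\<open>threshold_optimal\<close>). Its derivative therefore vanishes there, which is the identity.

  The same comparison, with the two factors exchanged and added, makes \<open>\<nu>\<close> decreasing. Hence
  \<open>\<nu>'\<close> has constant sign, and with the limit of \<open>\<nu>\<close> at infinity this makes it integrable on
  \<open>[1, \<infinity>)\<close> (\<open>integral_deriv_atLeast\<close>).
\<close>

section \<open>Measure-theoretic preliminaries\<close>

text \<open>
  If the inequality failed at a point of \<open>X\<close>, it would fail by a definite margin on a relative
  neighbourhood. As \<open>X\<close> lies in the closure of its interior, that neighbourhood contains a ball,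
  which has positive measure and serves as the set \<open>A\<close> of the hypothesis.
\<close>
lemma pointwise_le_if_nn_integral_le:
  fixes f g :: "'a::euclidean_space \<Rightarrow> real"
  assumes regular: "X \<subseteq> closure (interior X)"
    and f: "continuous_on X f" and g: "continuous_on X g"
    and g_nonneg: "\<And>x. x \<in> X \<Longrightarrow> 0 \<le> g x"
    and le: "\<And>A. A \<in> sets borel \<Longrightarrow> A \<subseteq> X \<Longrightarrow>
      (\<integral>\<^sup>+x\<in>A. ennreal (f x) \<partial>lborel) \<le> (\<integral>\<^sup>+x\<in>A. ennreal (g x) \<partial>lborel)"
    and x: "x \<in> X"
  shows "f x \<le> g x"
proof (rule ccontr)
  assume "\<not> f x \<le> g x"
  then obtain c d where cd: "g x < c" "c < d" "d < f x"
    by (meson dense not_le)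
  have c_pos: "0 < c"
    using g_nonneg[OF x] cd by linarith
  from continuous_on_open_invariant[THEN iffD1, OF g, rule_format, of "{..<c}"]
  obtain U where U: "open U" "U \<inter> X = g -` {..<c} \<inter> X" by auto
  from continuous_on_open_invariant[THEN iffD1, OF f, rule_format, of "{d<..}"]
  obtain V where V: "open V" "V \<inter> X = f -` {d<..} \<inter> X" by auto
  have "x \<in> U \<inter> V"
    using U V x cd by auto
  moreover have "x \<in> closure (interior X)"
    using regular x by blast
  ultimately obtain y where y: "y \<in> interior X \<inter> (U \<inter> V)"
    using open_Int_closure_eq_empty[OF open_Int[OF U(1) V(1)], of "interior X"] by blast
  moreover have "open (interior X \<inter> (U \<inter> V))"
    using U V by auto
  ultimately obtain r where r: "0 < r" "ball y r \<subseteq> interior X \<inter> (U \<inter> V)"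
    using open_contains_ball by metis
  let ?B = "ball y r"
  have B: "?B \<subseteq> X" "?B \<in> sets borel"
    using r interior_subset by auto
  have f_large: "d \<le> f z" if "z \<in> ?B" for z
    using that r V B by (auto simp: set_eq_iff subset_iff) (meson less_imp_le)
  have g_small: "g z \<le> c" if "z \<in> ?B" for z
    using that r U B by (auto simp: set_eq_iff subset_iff) (meson less_imp_le)
  have "ennreal d * emeasure lborel ?B = (\<integral>\<^sup>+z\<in>?B. ennreal d \<partial>lborel)"
    by (simp add: nn_integral_cmult_indicator)
  also have "\<dots> \<le> (\<integral>\<^sup>+z\<in>?B. ennreal (f z) \<partial>lborel)"
    by (intro nn_integral_mono) (auto simp: indicator_def intro!: ennreal_leI f_large)
  also have "\<dots> \<le> (\<integral>\<^sup>+z\<in>?B. ennreal (g z) \<partial>lborel)"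
    using B by (intro le)
  also have "\<dots> \<le> (\<integral>\<^sup>+z\<in>?B. ennreal c \<partial>lborel)"
    by (intro nn_integral_mono) (auto simp: indicator_def intro!: ennreal_leI g_small)
  also have "\<dots> = ennreal c * emeasure lborel ?B"
    by (simp add: nn_integral_cmult_indicator)
  finally have *: "ennreal d * emeasure lborel ?B \<le> ennreal c * emeasure lborel ?B" .
  have e: "emeasure lborel ?B = ennreal (measure lborel ?B)" "0 < measure lborel ?B"
    using r emeasure_lborel_ball_finite[of y r] content_ball_pos[of r y]
    by (simp_all add: emeasure_eq_ennreal_measure)
  from * have "d * measure lborel ?B \<le> c * measure lborel ?B"
    unfolding e(1) using c_pos cd e(2)
    by (simp add: ennreal_mult[symmetric])
  with e cd show False by simp
qed

text \<open>
  The defining property of a location density, extended from indicator functions to all nonnegative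
  \<open>h\<close>: both sides integrate \<open>h\<close> against the same measure, once as an image under \<open>loc\<close> and once by
  its density. This is the rule for integrating against \<open>\<delta> (x' - loc m)\<close>.
\<close>
lemma nn_integral_location_density:
  fixes loc :: "'m::euclidean_space \<Rightarrow> 'x::euclidean_space"
  assumes density: "is_location_density X loc D q f"
    and X: "X \<in> sets borel"
    and loc [measurable]: "loc \<in> borel_measurable borel"
    and q [measurable]: "q \<in> borel_measurable borel"
    and D: "{m. loc m \<in> X \<and> m \<in> D} \<in> sets borel" (is "?E \<in> _")
    and h [measurable]: "h \<in> borel_measurable borel"
  shows "(\<integral>\<^sup>+m. h (loc m) * ennreal (q m) * indicator ?E m \<partial>lborel) =
         (\<integral>\<^sup>+x'. h x' * ennreal (f x') * indicator X x' \<partial>lborel)"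
proof -
  note [measurable] = D X
  have "f \<in> borel_measurable (restrict_space borel X)"
    using density by (simp add: is_location_density_def)
  then have "(\<lambda>x. ennreal (f x)) \<in> borel_measurable (restrict_space borel X)"
    by measurable
  then have f [measurable]: "(\<lambda>x. ennreal (f x) * indicator X x) \<in> borel_measurable borel"
    using X by (subst (asm) borel_measurable_restrict_space_iff_ennreal) auto
  let ?N = "density lborel (\<lambda>m. ennreal (q m) * indicator ?E m)"
  have "distr ?N borel loc = density lborel (\<lambda>x. ennreal (f x) * indicator X x)"
  proof (rule measure_eqI)
    fix A assume "A \<in> sets (distr ?N borel loc)"
    then have A [measurable]: "A \<in> sets borel" by simp
    have AX: "{m. loc m \<in> A \<inter> X \<and> m \<in> D} = (loc -` A \<inter> space borel) \<inter> ?E"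
      by auto
    have [measurable]: "{m. loc m \<in> A \<inter> X \<and> m \<in> D} \<in> sets borel"
      unfolding AX by measurable
    have [measurable]: "loc -` A \<in> sets borel"
      by (rule measurable_sets_borel[OF loc A])
    have "emeasure (distr ?N borel loc) A = emeasure ?N (loc -` A)"
      by (simp add: emeasure_distr)
    also have "\<dots> = (\<integral>\<^sup>+m. ennreal (q m) * indicator ?E m * indicator (loc -` A) m \<partial>lborel)"
      by (rule emeasure_density) measurable
    also have "\<dots> =
        (\<integral>\<^sup>+m. ennreal (q m) * indicator {m. loc m \<in> A \<inter> X \<and> m \<in> D} m \<partial>lborel)"
      by (intro nn_integral_cong) (auto simp: indicator_def)
    also have "\<dots> = emeasure (density lborel (\<lambda>m. ennreal (q m))) {m. loc m \<in> A \<inter> X \<and> m \<in> D}"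
      by (rule emeasure_density[symmetric]) measurable
    also have "\<dots> = (\<integral>\<^sup>+x'\<in>A \<inter> X. ennreal (f x') \<partial>lborel)"
      using density X A unfolding is_location_density_def by blast
    also have "\<dots> = (\<integral>\<^sup>+x'\<in>A. (ennreal (f x') * indicator X x') \<partial>lborel)"
      by (intro nn_integral_cong) (auto simp: indicator_def)
    also have "\<dots> = emeasure (density lborel (\<lambda>x. ennreal (f x) * indicator X x)) A"
      by (rule emeasure_density[symmetric]) measurable
    finally show "emeasure (distr ?N borel loc) A = \<dots>" .
  qed simp
  then have "(\<integral>\<^sup>+x. h x \<partial>distr ?N borel loc) =
      (\<integral>\<^sup>+x. h x \<partial>density lborel (\<lambda>x. ennreal (f x) * indicator X x))"
    by simp
  then show ?thesis
    by (simp add: nn_integral_distr nn_integral_density mult_ac)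
qed

text \<open>
  Functions that are measurable only on a part of a product are extended by zero, so that Tonelli's
  theorem can be applied to products of full Lebesgue measures.
\<close>
lemma measurable_zero_extension:
  fixes f :: "'a \<Rightarrow> 'b \<Rightarrow> real"
  assumes f: "(\<lambda>(x, y). f x y) \<in> borel_measurable (restrict_space M A \<Otimes>\<^sub>M restrict_space N B)"
    and A: "A \<inter> space M \<in> sets M" and B: "B \<inter> space N \<in> sets N"
  shows "(\<lambda>(x, y). if x \<in> A \<and> y \<in> B then f x y else 0) \<in> borel_measurable (M \<Otimes>\<^sub>M N)"
proof -
  let ?P = "restrict_space (M \<Otimes>\<^sub>M N) (A \<times> B)"
  have AB: "(A \<times> B) \<inter> space (M \<Otimes>\<^sub>M N) \<in> sets (M \<Otimes>\<^sub>M N)"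
    using pair_measureI[OF A B] by (simp add: space_pair_measure Times_Int_Times)
  have fst: "fst \<in> measurable ?P (restrict_space M A)"
    by (intro measurable_restrict_space3) auto
  have snd: "snd \<in> measurable ?P (restrict_space N B)"
    by (intro measurable_restrict_space3) auto
  have "(\<lambda>p. (\<lambda>(x, y). f x y) (fst p, snd p)) \<in> borel_measurable ?P"
    by (rule measurable_compose[OF measurable_Pair[OF fst snd] f])
  then have "(\<lambda>p. if p \<in> A \<times> B then f (fst p) (snd p) else 0) \<in> borel_measurable (M \<Otimes>\<^sub>M N)"
    by (subst (asm) measurable_restrict_space_iff[OF AB, of 0])
      (simp_all add: case_prod_beta cong: if_cong)
  then show ?thesis
    by (simp add: mem_Times_iff case_prod_beta)
qed

text \<open>
  The fundamental theorem of calculus on a half-line. By monotonicity \<open>- f'\<close> is nonnegative, and it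
  is measurable as a pointwise limit of difference quotients, so its Lebesgue integral exists; it
  is finite because it equals the total decrease of \<open>f\<close>.
\<close>
lemma integral_deriv_atLeast:
  fixes f :: "real \<Rightarrow> real"
  assumes mono: "\<And>s t. 0 < s \<Longrightarrow> s \<le> t \<Longrightarrow> f t \<le> f s"
    and deriv: "\<And>t. 0 < t \<Longrightarrow> (f has_real_derivative f' t) (at t)"
    and lim: "(f \<longlongrightarrow> 0) at_top"
  shows "set_integrable lborel {1..} f' \<and> f 1 = - (LINT t:{1..}|lborel. f' t)"
proof -
  let ?g = "\<lambda>t. indicator {1..} t *\<^sub>R (- f' t)"
  have cont: "continuous_on {1..} (\<lambda>t. f (t + c))" if "0 \<le> c" for c
  proof (rule continuous_at_imp_continuous_on, rule ballI)
    fix t :: real assume "t \<in> {1..}"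
    with that deriv[of "t + c"] have "isCont f (t + c)"
      by (auto intro: DERIV_isCont)
    then show "isCont (\<lambda>t. f (t + c)) t"
      using isCont_o2[of t "\<lambda>t. t + c" f] by simp
  qed
  have meas: "?g \<in> borel_measurable borel"
  proof (rule borel_measurable_LIMSEQ_real)
    fix n :: nat
    have "continuous_on {1..} (\<lambda>t. (f t - f (t + inverse (real (Suc n)))) / inverse (real (Suc n)))"
      using cont[of 0] cont[of "inverse (real (Suc n))"]
      by (intro continuous_on_divide continuous_on_diff continuous_on_const) auto
    then show "(\<lambda>t. indicator {1..} t *\<^sub>R ((f t - f (t + inverse (real (Suc n)))) / inverse (real (Suc n))))
        \<in> borel_measurable borel"
      by (rule borel_measurable_continuous_on_indicator[rotated]) simp
  next
    fix t :: real
    show "(\<lambda>n. indicator {1..} t *\<^sub>R ((f t - f (t + inverse (real (Suc n)))) / inverse (real (Suc n))))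
        \<longlonglongrightarrow> ?g t"
    proof (cases "1 \<le> t")
      case True
      then have "((\<lambda>h. (f (t + h) - f t) / h) \<longlongrightarrow> f' t) (at 0)"
        using deriv[of t] by (simp add: DERIV_def)
      moreover have "filterlim (\<lambda>n. inverse (real (Suc n))) (at 0) sequentially"
        using LIMSEQ_inverse_real_of_nat by (auto simp: filterlim_at)
      ultimately have "(\<lambda>n. (f (t + inverse (real (Suc n))) - f t) / inverse (real (Suc n)))
          \<longlonglongrightarrow> f' t"
        by (rule filterlim_compose)
      from tendsto_minus[OF this] show ?thesis
        using True by (simp add: minus_divide_left)
    qed simp
  qed
  have nonneg: "0 \<le> - f' t" if "1 \<le> t" for t
  proof (rule ccontr)
    assume "\<not> 0 \<le> - f' t"
    then have "0 < f' t" by simp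
    from DERIV_pos_inc_right[OF deriv this] that
    obtain d where "0 < d" "\<And>h. 0 < h \<Longrightarrow> h < d \<Longrightarrow> f t < f (t + h)" by auto
    then have "f t < f (t + d / 2)" by simp
    with mono[of t "t + d / 2"] that \<open>0 < d\<close> show False by simp
  qed
  have "(\<integral>\<^sup>+t. ennreal (?g t) * indicator {1..} t \<partial>lborel) = ennreal (0 - (- f 1))"
  proof (rule nn_integral_FTC_atLeast[OF meas])
    fix t :: real assume t: "1 \<le> t"
    show "((\<lambda>t. - f t) has_real_derivative ?g t) (at t)"
      using t by (auto intro!: derivative_eq_intros deriv)
    show "0 \<le> ?g t"
      using nonneg t by simp
  next
    show "((\<lambda>t. - f t) \<longlongrightarrow> 0) at_top"
      using tendsto_minus[OF lim] by simp
  qed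
  then have nn: "(\<integral>\<^sup>+t. ennreal (?g t) \<partial>lborel) = ennreal (f 1)"
    by (subst nn_integral_cong[where v = "\<lambda>t. ennreal (?g t) * indicator {1..} t"])
      (auto simp: indicator_def)
  have f1: "0 \<le> f 1"
    by (rule tendsto_upperbound[OF lim]) (auto intro!: eventually_at_top_linorderI[of 1] mono)
  have "has_bochner_integral lborel ?g (f 1)"
    using nonneg f1 nn meas
    by (intro has_bochner_integral_nn_integral) (auto simp: indicator_def)
  from has_bochner_integral_minus[OF this]
  have "has_bochner_integral lborel (\<lambda>t. indicator {1..} t *\<^sub>R f' t) (- f 1)"
    by simp
  then show ?thesis
    by (simp add: set_integrable_def set_lebesgue_integral_def has_bochner_integral_iff)
qed


section \<open>Declaration regions and their measurability\<close>

context regular_detection_estimation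
begin

definition weight :: "'x \<Rightarrow> 'x \<Rightarrow> real" where
  "weight x' x = R x' x / C x' * (a x / a0)"

definition average_detection :: "'x \<Rightarrow> real \<Rightarrow> real" where
  "average_detection x' \<mu> = (LINT x:X|lborel. R x' x / C x' * pD x' x \<mu> * (a x / a0))"

definition declared_in :: "'x set \<Rightarrow> real \<Rightarrow> 'm set" where
  "declared_in A \<mu> = {m. loc m \<in> A \<and> 0 < decision_stat X a0 a p0 p1 C R (loc m) \<mu> m}"

text \<open>
  The posterior expected reward at \<open>loc m\<close>, rescaled by \<open>p(m) / (C (loc m) * a0)\<close> so that it competes
  with \<open>\<mu> * p0 m\<close>. Its values lie in \<open>[0, \<infinity>]\<close>, as in Tonelli's theorem;
  \<open>benefit_if_declared\<close> recovers the real integral wherever a signal is declared.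
\<close>
definition benefit :: "'m \<Rightarrow> ennreal" where
  "benefit m = (\<integral>\<^sup>+x\<in>X. ennreal (weight (loc m) x * p1 m x) \<partial>lborel)"

lemma weight_nonneg: "x' \<in> X \<Longrightarrow> x \<in> X \<Longrightarrow> 0 \<le> weight x' x"
  unfolding weight_def using R_nonneg a_nonneg C_pos[of x'] a0_pos by simp

lemma pD_nonneg: "x' \<in> X \<Longrightarrow> x \<in> X \<Longrightarrow> 0 < \<mu> \<Longrightarrow> 0 \<le> pD x' x \<mu>"
  using pD_density[of x \<mu>] by (simp add: is_location_density_def)

lemma \<nu>F_nonneg: "x' \<in> X \<Longrightarrow> 0 < \<mu> \<Longrightarrow> 0 \<le> \<nu>F x' \<mu>"
  using \<nu>F_density[of \<mu>] by (simp add: is_location_density_def)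

lemma average_detection_nonneg: "x' \<in> X \<Longrightarrow> 0 < \<mu> \<Longrightarrow> 0 \<le> average_detection x' \<mu>"
  unfolding average_detection_def set_lebesgue_integral_def
  using R_nonneg a_nonneg C_pos[of x'] a0_pos pD_nonneg
  by (intro Bochner_Integration.integral_nonneg) (auto simp: indicator_def)

lemma marginal_density_nonneg: "0 \<le> marginal_density X a0 a p0 p1 m"
  unfolding marginal_density_def set_lebesgue_integral_def
  using a0_pos p0_nonneg[of m] a_nonneg p1_nonneg
  by (intro add_nonneg_nonneg mult_nonneg_nonneg Bochner_Integration.integral_nonneg) (auto simp: indicator_def)

lemma prior_measurable: "(\<lambda>x. if x \<in> X then a x else 0) \<in> borel_measurable borel"
proof -
  have "(\<lambda>x. indicator X x *\<^sub>R a x) \<in> borel_measurable borel"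
    using a_integrable by (simp add: set_integrable_def integrable_iff_bounded)
  then show ?thesis
    by (rule measurable_cong[THEN iffD1, rotated]) (simp add: indicator_def)
qed

lemma cost_measurable: "(\<lambda>x. if x \<in> X then C x else 0) \<in> borel_measurable borel"
  by (rule measurable_cong[THEN iffD1, OF _
        borel_measurable_continuous_on_indicator[OF domain_borel C_continuous]])
    (simp add: indicator_def)

lemma reward_measurable:
  "(\<lambda>(x', x). if x' \<in> X \<and> x \<in> X then R x' x else 0) \<in> borel_measurable (borel \<Otimes>\<^sub>M borel)"
proof -
  have "X \<times> X \<in> sets borel"
    using domain_borel by (metis borel_prod pair_measureI)
  from borel_measurable_continuous_on_indicator[OF this R_continuous]
  show ?thesis
    unfolding borel_prod
    by (rule measurable_cong[THEN iffD1, rotated]) (auto simp: indicator_def split: if_split_asm)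
qed

lemma likelihood_measurable:
  "(\<lambda>(m, x). if x \<in> X then p1 m x else 0) \<in> borel_measurable (borel \<Otimes>\<^sub>M borel)"
  using measurable_zero_extension[of p1 borel UNIV borel X] p1_measurable domain_borel
  by simp

lemma detection_measurable:
  assumes "0 < \<mu>"
  shows "(\<lambda>(x', x). if x' \<in> X \<and> x \<in> X then pD x' x \<mu> else 0)
    \<in> borel_measurable (borel \<Otimes>\<^sub>M borel)"
  using measurable_zero_extension[OF pD_measurable[OF assms]] domain_borel by simp

lemma weight_measurable:
  "(\<lambda>(x', x). if x' \<in> X \<and> x \<in> X then weight x' x else 0)
    \<in> borel_measurable (borel \<Otimes>\<^sub>M borel)"
proof -
  note [measurable] = prior_measurable cost_measurable reward_measurable
  have "(\<lambda>p. (\<lambda>(x', x). if x' \<in> X \<and> x \<in> X then R x' x else 0) p /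
      (if fst p \<in> X then C (fst p) else 0) * ((if snd p \<in> X then a (snd p) else 0) / a0))
    \<in> borel_measurable (borel \<Otimes>\<^sub>M borel)"
    by measurable
  then show ?thesis
    by (rule measurable_cong[THEN iffD1, rotated]) (auto simp: weight_def)
qed

lemma weighted_likelihood_measurable:
  "(\<lambda>(m, x). ennreal (if loc m \<in> X \<and> x \<in> X then weight (loc m) x * p1 m x else 0))
    \<in> borel_measurable (borel \<Otimes>\<^sub>M borel)"
proof -
  note [measurable] = weight_measurable likelihood_measurable loc_measurable
  have "(\<lambda>q. ennreal ((\<lambda>(x', x). if x' \<in> X \<and> x \<in> X then weight x' x else 0) (loc (fst q), snd q) *
      (\<lambda>(m, x). if x \<in> X then p1 m x else 0) q)) \<in> borel_measurable (borel \<Otimes>\<^sub>M borel)"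
    by measurable
  then show ?thesis
    by (rule measurable_cong[THEN iffD1, rotated]) auto
qed

lemma declared_in_measurable:
  assumes A: "A \<in> sets borel" "A \<subseteq> X"
  shows "declared_in A \<mu> \<in> sets borel"
proof -
  note [measurable] = prior_measurable cost_measurable reward_measurable likelihood_measurable
    loc_measurable p0_measurable A(1)
  let ?a = "\<lambda>x. if x \<in> X then a x else 0"
  let ?C = "\<lambda>x. if x \<in> X then C x else 0"
  let ?R = "\<lambda>(x', x). if x' \<in> X \<and> x \<in> X then R x' x else 0"
  let ?p1 = "\<lambda>(m, x). if x \<in> X then p1 m x else 0"
  let ?marg = "\<lambda>m. a0 * p0 m + (LINT x|lborel. ?a x * ?p1 (m, x))"
  let ?rew = "\<lambda>m. LINT x|lborel. ?R (loc m, x) * ?p1 (m, x) * ?a x"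
  have [measurable]: "?marg \<in> borel_measurable borel" "?rew \<in> borel_measurable borel"
    by measurable
  have marg: "marginal_density X a0 a p0 p1 m = ?marg m" for m
    by (auto simp: marginal_density_def set_lebesgue_integral_def indicator_def
        intro!: Bochner_Integration.integral_cong)
  have rew: "(LINT x:X|lborel. R (loc m) x * p1 m x * a x) = ?rew m" if "loc m \<in> X" for m
    using that by (auto simp: set_lebesgue_integral_def indicator_def
        intro!: Bochner_Integration.integral_cong)
  have "declared_in A \<mu> = {m \<in> space borel. loc m \<in> A \<and>
      0 < 1 / ?marg m * (?rew m - \<mu> * ?C (loc m) * p0 m * a0)}"
    using A(2) unfolding declared_in_def decision_stat_def marg by (auto simp: rew subset_iff)
  also have "\<dots> \<in> sets borel"
    by measurable
  finally show ?thesis .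
qed

section \<open>Integrals of the densities as integrals over measurements\<close>

lemma nn_integral_false_alarm:
  assumes "A \<in> sets borel" "A \<subseteq> X" "0 < \<mu>"
  shows "(\<integral>\<^sup>+x'\<in>A. ennreal (\<nu>F x' \<mu>) \<partial>lborel) =
         (\<integral>\<^sup>+m\<in>declared_in A \<mu>. ennreal (p0 m) \<partial>lborel)"
proof -
  have "(\<integral>\<^sup>+x'\<in>A. ennreal (\<nu>F x' \<mu>) \<partial>lborel) =
      emeasure (density lborel (\<lambda>m. ennreal (p0 m))) (declared_in A \<mu>)"
    using \<nu>F_density[OF assms(3)] assms(1,2)
    by (simp add: is_location_density_def declared_in_def)
  also have "\<dots> = (\<integral>\<^sup>+m\<in>declared_in A \<mu>. ennreal (p0 m) \<partial>lborel)"
    using p0_measurable declared_in_measurable[OF assms(1,2)]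
    by (intro emeasure_density) auto
  finally show ?thesis .
qed

text \<open>
  For each fixed \<open>x\<close> the detection density turns an integral over locations into one over
  measurements; averaging over \<open>x\<close> and applying Tonelli before and after gives the claim.
\<close>
lemma nn_integral_average_detection:
  assumes A: "A \<in> sets borel" "A \<subseteq> X" and \<mu>: "0 < \<mu>"
  shows "(\<integral>\<^sup>+x'\<in>A. ennreal (average_detection x' \<mu>) \<partial>lborel) =
         (\<integral>\<^sup>+m\<in>declared_in A \<mu>. benefit m \<partial>lborel)"
proof -
  let ?W = "\<lambda>(x', x). if x' \<in> X \<and> x \<in> X then weight x' x else 0"
  let ?D = "\<lambda>(x', x). if x' \<in> X \<and> x \<in> X then pD x' x \<mu> else 0"
  let ?L = "\<lambda>(m, x). ennreal (if loc m \<in> X \<and> x \<in> X then weight (loc m) x * p1 m x else 0)"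
  note [measurable] = A(1) domain_borel loc_measurable weight_measurable
    detection_measurable[OF \<mu>] declared_in_measurable[OF A] weighted_likelihood_measurable
  have "(\<integral>\<^sup>+x'\<in>A. ennreal (average_detection x' \<mu>) \<partial>lborel) =
      (\<integral>\<^sup>+x'. (\<integral>\<^sup>+x. ennreal (?W (x', x) * ?D (x', x)) * indicator A x' \<partial>lborel) \<partial>lborel)"
  proof (intro nn_integral_cong)
    fix x'
    show "ennreal (average_detection x' \<mu>) * indicator A x' =
        (\<integral>\<^sup>+x. ennreal (?W (x', x) * ?D (x', x)) * indicator A x' \<partial>lborel)"
    proof (cases "x' \<in> A")
      case True
      with A have x': "x' \<in> X" by auto
      have "ennreal (average_detection x' \<mu>) =
          (\<integral>\<^sup>+x. ennreal (indicator X x *\<^sub>R (R x' x / C x' * pD x' x \<mu> * (a x / a0))) \<partial>lborel)"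
        unfolding average_detection_def set_lebesgue_integral_def
        using average_integrable[OF x' \<mu>] pD_nonneg[OF x' _ \<mu>]
          R_nonneg[OF x'] a_nonneg C_pos[OF x'] a0_pos
        by (intro nn_integral_eq_integral[symmetric])
          (auto simp: set_integrable_def indicator_def)
      also have "\<dots> = (\<integral>\<^sup>+x. ennreal (?W (x', x) * ?D (x', x)) * indicator A x' \<partial>lborel)"
        using True x'
        by (intro nn_integral_cong) (auto simp: weight_def indicator_def ac_simps)
      finally show ?thesis
        using True by simp
    qed simp
  qed
  also have "\<dots> =
      (\<integral>\<^sup>+x. (\<integral>\<^sup>+x'. ennreal (?W (x', x) * ?D (x', x)) * indicator A x' \<partial>lborel) \<partial>lborel)"
    by (rule lborel_pair.Fubini') measurable
  also have "\<dots> = (\<integral>\<^sup>+x. (\<integral>\<^sup>+m. ?L (m, x) * indicator (declared_in A \<mu>) m \<partial>lborel) \<partial>lborel)"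
  proof (intro nn_integral_cong)
    fix x :: 'x
    show "(\<integral>\<^sup>+x'. ennreal (?W (x', x) * ?D (x', x)) * indicator A x' \<partial>lborel) =
        (\<integral>\<^sup>+m. ?L (m, x) * indicator (declared_in A \<mu>) m \<partial>lborel)"
    proof (cases "x \<in> X")
      case x: True
      have q: "(\<lambda>m. p1 m x) \<in> borel_measurable borel"
        using measurable_compose[OF measurable_Pair2'[of x borel borel] likelihood_measurable] x
        by simp
      have h: "(\<lambda>x'. ennreal (?W (x', x)) * indicator A x') \<in> borel_measurable borel"
        by measurable
      have S: "{m. loc m \<in> X \<and> m \<in> {m. 0 < decision_stat X a0 a p0 p1 C R (loc m) \<mu> m}}
          \<in> sets borel"
        using declared_in_measurable[OF domain_borel order_refl, of \<mu>]
        by (simp add: declared_in_def)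
      \<comment> \<open>The indicator of \<open>A\<close> joins the test function, so that \<open>A\<close> reappears as a condition on \<open>loc m\<close>.\<close>
      have "(\<integral>\<^sup>+x'. ennreal (?W (x', x) * ?D (x', x)) * indicator A x' \<partial>lborel) =
          (\<integral>\<^sup>+x'. (ennreal (?W (x', x)) * indicator A x') * ennreal (pD x' x \<mu>) * indicator X x'
            \<partial>lborel)"
        using x weight_nonneg A(2)
        by (intro nn_integral_cong) (auto simp: ennreal_mult' indicator_def)
      also have "\<dots> = (\<integral>\<^sup>+m. (ennreal (?W (loc m, x)) * indicator A (loc m)) * ennreal (p1 m x) *
          indicator {m. loc m \<in> X \<and> m \<in> {m. 0 < decision_stat X a0 a p0 p1 C R (loc m) \<mu> m}} m
            \<partial>lborel)"
        by (rule nn_integral_location_density[OF pD_density[OF x \<mu>] domain_borel loc_measurable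
              q S h, symmetric])
      also have "\<dots> = (\<integral>\<^sup>+m. ?L (m, x) * indicator (declared_in A \<mu>) m \<partial>lborel)"
        using x weight_nonneg A(2)
        by (intro nn_integral_cong) (auto simp: ennreal_mult' indicator_def declared_in_def)
      finally show ?thesis .
    qed simp
  qed
  also have "\<dots> = (\<integral>\<^sup>+m. (\<integral>\<^sup>+x. ?L (m, x) * indicator (declared_in A \<mu>) m \<partial>lborel) \<partial>lborel)"
    by (rule lborel_pair.Fubini') measurable
  also have "\<dots> = (\<integral>\<^sup>+m\<in>declared_in A \<mu>. benefit m \<partial>lborel)"
    unfolding benefit_def
    using A(2)
    by (intro nn_integral_cong)
      (auto simp: declared_in_def indicator_def subset_iff intro!: nn_integral_cong)
  finally show ?thesis .
qed

lemma benefit_measurable: "(\<lambda>m. benefit m * indicator (declared_in X \<mu>) m) \<in> borel_measurable borel"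
proof -
  note [measurable] = declared_in_measurable[OF domain_borel order_refl]
    weighted_likelihood_measurable
  have "(\<lambda>m. (\<integral>\<^sup>+x. (\<lambda>(m, x). ennreal (if loc m \<in> X \<and> x \<in> X then weight (loc m) x * p1 m x else 0))
      (m, x) \<partial>lborel) * indicator (declared_in X \<mu>) m) \<in> borel_measurable borel"
    by measurable
  then show ?thesis
    by (rule measurable_cong[THEN iffD1, rotated])
      (auto simp: benefit_def declared_in_def indicator_def intro!: nn_integral_cong)
qed

section \<open>Optimality of the declaration region\<close>

text \<open>
  A non-integrable function has Bochner integral 0, and then the decision statistic cannot be positive.
  So wherever a signal is declared the reward integral converges and agrees with its extended
  nonnegative version.
\<close>
lemma benefit_if_declared:
  assumes m: "m \<in> declared_in X s" and s: "0 < s"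
  shows "benefit m = ennreal ((LINT x:X|lborel. R (loc m) x * p1 m x * a x) / (C (loc m) * a0))"
proof -
  let ?f = "\<lambda>x. indicator X x *\<^sub>R (R (loc m) x * p1 m x * a x)"
  have loc: "loc m \<in> X" and "0 < decision_stat X a0 a p0 p1 C R (loc m) s m"
    using m by (auto simp: declared_in_def)
  then have "0 < (LINT x:X|lborel. R (loc m) x * p1 m x * a x) - s * C (loc m) * p0 m * a0"
    using marginal_density_nonneg[of m]
    by (auto simp: decision_stat_def zero_less_mult_iff zero_less_divide_iff)
  moreover have "0 \<le> s * C (loc m) * p0 m * a0"
    using s C_pos[OF loc] p0_nonneg[of m] a0_pos by simp
  ultimately have "integral\<^sup>L lborel ?f \<noteq> 0"
    unfolding set_lebesgue_integral_def by linarith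
  then have int: "integrable lborel ?f"
    using not_integrable_integral_eq by blast
  have C: "0 < C (loc m) * a0"
    using C_pos[OF loc] a0_pos by simp
  have "benefit m = (\<integral>\<^sup>+x. ennreal (?f x / (C (loc m) * a0)) \<partial>lborel)"
    unfolding benefit_def
    by (intro nn_integral_cong) (auto simp: weight_def indicator_def field_simps)
  also have "\<dots> = ennreal (integral\<^sup>L lborel (\<lambda>x. ?f x / (C (loc m) * a0)))"
    using int C loc R_nonneg p1_nonneg a_nonneg
    by (intro nn_integral_eq_integral) (auto simp: indicator_def intro!: divide_nonneg_pos mult_nonneg_nonneg)
  finally show ?thesis
    by (simp add: set_lebesgue_integral_def)
qed

text \<open>
  The integrand \<open>benefit m - s * p0 m\<close> is nonnegative where a signal is declared at factor \<open>s\<close> but not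
  at \<open>t\<close>, and nonpositive where the reverse holds. The subtracted terms are moved to the other side
  because the values are extended nonnegative reals.
\<close>
lemma declared_region_optimal:
  assumes s: "0 < s" and t: "0 < t" and A: "A \<subseteq> X"
  shows "benefit m * indicator (declared_in A t) m + ennreal s * (ennreal (p0 m) * indicator (declared_in A s) m)
       \<le> benefit m * indicator (declared_in A s) m + ennreal s * (ennreal (p0 m) * indicator (declared_in A t) m)"
proof -
  let ?S = "LINT x:X|lborel. R (loc m) x * p1 m x * a x"
  let ?b = "?S / (C (loc m) * a0)"
  have pos: "0 < C (loc m) * a0" if "loc m \<in> A"
    using that A C_pos[of "loc m"] a0_pos by auto
  have declared_iff: "m \<in> declared_in A \<mu> \<longleftrightarrow>
      loc m \<in> A \<and> 0 < marginal_density X a0 a p0 p1 m \<and> \<mu> * p0 m < ?b" for \<mu>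
  proof (cases "loc m \<in> A")
    case True
    \<comment> \<open>If the marginal density is 0, division by zero makes the statistic 0 and nothing is declared.\<close>
    have "0 < 1 / p * y \<longleftrightarrow> 0 < p \<and> 0 < y" if "0 \<le> p" for p y :: real
      using that by (cases "p = 0") (auto simp: zero_less_divide_iff)
    from this[OF marginal_density_nonneg]
    have "m \<in> declared_in A \<mu> \<longleftrightarrow> 0 < marginal_density X a0 a p0 p1 m \<and>
        0 < ?S - \<mu> * C (loc m) * p0 m * a0"
      using True unfolding declared_in_def decision_stat_def by simp
    moreover have "0 < S - \<mu> * C (loc m) * p0 m * a0 \<longleftrightarrow> \<mu> * p0 m < S / (C (loc m) * a0)" for S
      using pos[OF True] by (simp add: pos_less_divide_eq ac_simps)
    ultimately show ?thesis
      using True by simp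
  qed (simp add: declared_in_def)
  have benefit: "benefit m = ennreal ?b" if "m \<in> declared_in A \<mu>" "0 < \<mu>" for \<mu>
    using that A by (intro benefit_if_declared[of m \<mu>]) (auto simp: declared_in_def)
  have sp0: "ennreal s * ennreal (p0 m) = ennreal (s * p0 m)"
    using s by (simp add: ennreal_mult')
  consider "m \<in> declared_in A s \<longleftrightarrow> m \<in> declared_in A t"
    | "m \<in> declared_in A s" "m \<notin> declared_in A t"
    | "m \<notin> declared_in A s" "m \<in> declared_in A t"
    by blast
  then show ?thesis
  proof cases
    case 1
    then show ?thesis
      by (simp add: indicator_def)
  next
    case 2
    then have "ennreal (s * p0 m) \<le> benefit m"
      using benefit[OF 2(1) s] declared_iff[of s] by (auto intro!: ennreal_leI)
    with 2 show ?thesis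
      by (simp add: sp0)
  next
    case 3
    then have "benefit m \<le> ennreal (s * p0 m)"
      using benefit[OF 3(2) t] declared_iff[of s] declared_iff[of t]
      by (auto intro!: ennreal_leI)
    with 3 show ?thesis
      by (simp add: sp0)
  qed
qed

text \<open>
  Integrating the optimality of the region over the measurements located in an arbitrary \<open>A\<close> compares
  the densities on average over \<open>A\<close>; continuity in \<open>x'\<close> makes the comparison pointwise.
\<close>
lemma threshold_optimal:
  assumes x': "x' \<in> X" and s: "0 < s" and t: "0 < t"
  shows "average_detection x' t - s * \<nu>F x' t \<le> average_detection x' s - s * \<nu>F x' s"
proof -
  have "average_detection x' t + s * \<nu>F x' s \<le> average_detection x' s + s * \<nu>F x' t"
  proof (rule pointwise_le_if_nn_integral_le[OF domain_regular _ _ _ _ x'])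
    have cont: "continuous_on X (\<lambda>x'. average_detection x' u)" if "0 < u" for u
      unfolding average_detection_def by (rule average_continuous[OF that])
    show "continuous_on X (\<lambda>x'. average_detection x' t + s * \<nu>F x' s)"
      by (intro continuous_intros cont \<nu>F_continuous s t)
    show "continuous_on X (\<lambda>x'. average_detection x' s + s * \<nu>F x' t)"
      by (intro continuous_intros cont \<nu>F_continuous s t)
    show "0 \<le> average_detection x s + s * \<nu>F x t" if "x \<in> X" for x
      using average_detection_nonneg[OF that s] \<nu>F_nonneg[OF that t] s by simp
  next
    fix A :: "'x set" assume A: "A \<in> sets borel" "A \<subseteq> X"
    have nuF: "(\<lambda>x'. ennreal (\<nu>F x' u) * indicator A x') \<in> borel_measurable borel"
      and av: "(\<lambda>x'. ennreal (average_detection x' u) * indicator A x') \<in> borel_measurable borel"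
      if "0 < u" for u
    proof -
      have "(\<lambda>x'. ennreal (\<nu>F x' u)) \<in> borel_measurable (restrict_space borel A)"
        using borel_measurable_continuous_on_restrict[OF continuous_on_subset[OF \<nu>F_continuous[OF that] A(2)]]
        by measurable
      then show "(\<lambda>x'. ennreal (\<nu>F x' u) * indicator A x') \<in> borel_measurable borel"
        using A(1) by (subst (asm) borel_measurable_restrict_space_iff_ennreal) auto
      have "(\<lambda>x'. ennreal (average_detection x' u)) \<in> borel_measurable (restrict_space borel A)"
        using borel_measurable_continuous_on_restrict[OF continuous_on_subset[OF average_continuous[OF that] A(2)]]
        unfolding average_detection_def by measurable
      then show "(\<lambda>x'. ennreal (average_detection x' u) * indicator A x') \<in> borel_measurable borel"
        using A(1) by (subst (asm) borel_measurable_restrict_space_iff_ennreal) auto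
    qed
    have p0: "(\<lambda>m. ennreal (p0 m) * indicator (declared_in A u) m) \<in> borel_measurable borel" for u
      using p0_measurable declared_in_measurable[OF A] by measurable
    have ben: "(\<lambda>m. benefit m * indicator (declared_in A u) m) \<in> borel_measurable borel" for u
    proof -
      have "(\<lambda>m. benefit m * indicator (declared_in X u) m * indicator (declared_in A u) m)
          \<in> borel_measurable borel"
        using benefit_measurable[of u] declared_in_measurable[OF A, of u] by measurable
      then show ?thesis
        by (rule measurable_cong[THEN iffD1, rotated])
          (use A(2) in \<open>auto simp: declared_in_def indicator_def\<close>)
    qed
    \<comment> \<open>Stated for two independent factors, since each side of the comparison mixes \<open>s\<close> and \<open>t\<close>.\<close>
    have split: "(\<integral>\<^sup>+x'\<in>A. ennreal (average_detection x' u + s * \<nu>F x' v) \<partial>lborel) =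
        (\<integral>\<^sup>+m. benefit m * indicator (declared_in A u) m +
          ennreal s * (ennreal (p0 m) * indicator (declared_in A v) m) \<partial>lborel)"
      if u: "0 < u" and v: "0 < v" for u v
    proof -
      have "(\<integral>\<^sup>+x'\<in>A. ennreal (average_detection x' u + s * \<nu>F x' v) \<partial>lborel) =
          (\<integral>\<^sup>+x'. ennreal (average_detection x' u) * indicator A x' +
            ennreal s * (ennreal (\<nu>F x' v) * indicator A x') \<partial>lborel)"
        using average_detection_nonneg[OF _ u] \<nu>F_nonneg[OF _ v] s A(2)
        by (intro nn_integral_cong) (auto simp: indicator_def ennreal_mult' subset_iff)
      also have "\<dots> = (\<integral>\<^sup>+x'\<in>A. ennreal (average_detection x' u) \<partial>lborel) +
          ennreal s * (\<integral>\<^sup>+x'\<in>A. ennreal (\<nu>F x' v) \<partial>lborel)"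
        using av[OF u] nuF[OF v] by (simp add: nn_integral_add nn_integral_cmult)
      also have "\<dots> = (\<integral>\<^sup>+m\<in>declared_in A u. benefit m \<partial>lborel) +
          ennreal s * (\<integral>\<^sup>+m\<in>declared_in A v. ennreal (p0 m) \<partial>lborel)"
        by (simp only: nn_integral_average_detection[OF A u] nn_integral_false_alarm[OF A v])
      also have "\<dots> = (\<integral>\<^sup>+m. benefit m * indicator (declared_in A u) m +
          ennreal s * (ennreal (p0 m) * indicator (declared_in A v) m) \<partial>lborel)"
        using ben[of u] p0[of v] by (simp add: nn_integral_add nn_integral_cmult)
      finally show ?thesis .
    qed
    show "(\<integral>\<^sup>+x'\<in>A. ennreal (average_detection x' t + s * \<nu>F x' s) \<partial>lborel)
        \<le> (\<integral>\<^sup>+x'\<in>A. ennreal (average_detection x' s + s * \<nu>F x' t) \<partial>lborel)"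
      unfolding split[OF t s] split[OF s t]
      by (intro nn_integral_mono declared_region_optimal s t A(2))
  qed
  then show ?thesis by simp
qed

section \<open>The false-alarm density as an integral\<close>

text \<open>
  Adding the optimality of \<open>s\<close> against \<open>t\<close> to that of \<open>t\<close> against \<open>s\<close> cancels the average detection
  density.
\<close>
lemma \<nu>F_antimono:
  assumes x': "x' \<in> X" and "0 < s" "s \<le> t"
  shows "\<nu>F x' t \<le> \<nu>F x' s"
proof -
  have "(t - s) * \<nu>F x' t \<le> (t - s) * \<nu>F x' s"
    using threshold_optimal[OF x', of s t] threshold_optimal[OF x', of t s] assms
    by (simp add: algebra_simps)
  then show ?thesis
    using assms by (cases "s = t") auto
qed

text \<open>The first-order condition at the maximizer \<open>t = \<mu>\<close> of \<open>threshold_optimal\<close>.\<close>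
lemma deriv_average_detection:
  assumes x': "x' \<in> X" and \<mu>: "0 < \<mu>"
  shows "deriv (average_detection x') \<mu> = \<mu> * deriv (\<nu>F x') \<mu>"
proof -
  have av: "(average_detection x' has_real_derivative deriv (average_detection x') \<mu>) (at \<mu>)"
  proof -
    obtain D where "(average_detection x' has_real_derivative D) (at \<mu>)"
      using derivative_interchange[OF x' \<mu>] unfolding average_detection_def[abs_def] by blast
    then show ?thesis
      using DERIV_imp_deriv by blast
  qed
  have nu: "(\<nu>F x' has_real_derivative deriv (\<nu>F x') \<mu>) (at \<mu>)"
    using \<nu>F_differentiable[OF x' \<mu>] DERIV_deriv_iff_real_differentiable by blast
  have "deriv (average_detection x') \<mu> - \<mu> * deriv (\<nu>F x') \<mu> = 0"
  proof (rule DERIV_local_max)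
    show "((\<lambda>t. average_detection x' t - \<mu> * \<nu>F x' t) has_real_derivative
        deriv (average_detection x') \<mu> - \<mu> * deriv (\<nu>F x') \<mu>) (at \<mu>)"
      by (intro DERIV_diff DERIV_cmult av nu)
    show "\<forall>t. \<bar>\<mu> - t\<bar> < \<mu> \<longrightarrow>
        average_detection x' t - \<mu> * \<nu>F x' t \<le> average_detection x' \<mu> - \<mu> * \<nu>F x' \<mu>"
      using threshold_optimal[OF x' \<mu>] by auto
  qed (rule \<mu>)
  then show ?thesis by simp
qed

lemma \<nu>F_eq_integral_deriv_average_detection:
  assumes x': "x' \<in> X"
  shows "set_integrable lborel {1..} (\<lambda>\<mu>. 1 / \<mu> * deriv (average_detection x') \<mu>)
       \<and> \<nu>F x' 1 = - (LINT \<mu>:{1..}|lborel. 1 / \<mu> * deriv (average_detection x') \<mu>)"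
proof -
  have eq: "1 / \<mu> * deriv (average_detection x') \<mu> = deriv (\<nu>F x') \<mu>" if "1 \<le> \<mu>" for \<mu>
    using deriv_average_detection[OF x', of \<mu>] that by simp
  have "set_integrable lborel {1..} (deriv (\<nu>F x')) \<and>
      \<nu>F x' 1 = - (LINT \<mu>:{1..}|lborel. deriv (\<nu>F x') \<mu>)"
  proof (rule integral_deriv_atLeast)
    show "\<nu>F x' t \<le> \<nu>F x' s" if "0 < s" "s \<le> t" for s t
      using \<nu>F_antimono[OF x' that] .
    show "(\<nu>F x' has_real_derivative deriv (\<nu>F x') t) (at t)" if "0 < t" for t
      using \<nu>F_differentiable[OF x' that] DERIV_deriv_iff_real_differentiable by blast
    show "(\<nu>F x' \<longlongrightarrow> 0) at_top"
      by (rule \<nu>F_vanishes[OF x'])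
  qed
  moreover have "set_integrable lborel {1..} (\<lambda>\<mu>. 1 / \<mu> * deriv (average_detection x') \<mu>) \<longleftrightarrow>
      set_integrable lborel {1..} (deriv (\<nu>F x'))"
    by (rule set_integrable_cong[OF refl refl eq]) simp
  moreover have "(LINT \<mu>:{1..}|lborel. 1 / \<mu> * deriv (average_detection x') \<mu>) =
      (LINT \<mu>:{1..}|lborel. deriv (\<nu>F x') \<mu>)"
    by (rule set_lebesgue_integral_cong) (use eq in auto)
  ultimately show ?thesis by simp
qed

end

theorem theorem1:
  fixes X :: "'x::euclidean_space set"
    and a0 :: real
    and a :: "'x \<Rightarrow> real"
    and p0 :: "'m::euclidean_space \<Rightarrow> real"
    and p1 :: "'m \<Rightarrow> 'x \<Rightarrow> real"
    and C :: "'x \<Rightarrow> real"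
    and R :: "'x \<Rightarrow> 'x \<Rightarrow> real"
    and loc :: "'m \<Rightarrow> 'x"
    and pD :: "'x \<Rightarrow> 'x \<Rightarrow> real \<Rightarrow> real"
    and \<nu>F :: "'x \<Rightarrow> real \<Rightarrow> real"
    and x' :: 'x
  assumes "regular_detection_estimation X a0 a p0 p1 C R loc pD \<nu>F"
    and "x' \<in> X"
  shows "set_integrable lborel {1..} (\<lambda>\<mu>. 1 / \<mu> *
           deriv (\<lambda>t. LINT x:X|lborel. R x' x / C x' * pD x' x t * (a x / a0)) \<mu>)
       \<and> \<nu>F x' 1 = - (LINT \<mu>:{1..}|lborel. 1 / \<mu> *
           deriv (\<lambda>t. LINT x:X|lborel. R x' x / C x' * pD x' x t * (a x / a0)) \<mu>)"
proof -
  interpret regular_detection_estimation X a0 a p0 p1 C R loc pD \<nu>F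
    by (rule assms(1))
  show ?thesis
    using \<nu>F_eq_integral_deriv_average_detection[OF assms(2)]
    unfolding average_detection_def[abs_def] .
qed

end
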